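(* Let $A=\beta(I-A_1)\in\mathcal{QT}_\infty$ with $\beta>0$, $A_1\ge 0$ and $\|A_1\|_\infty<1$. Let $B=T(b)+E_B\in\mathcal{QT}_\infty$ be the unique matrix in $\mathcal{QT}_\infty$ such that $B\ge 0$, $\|B\|_\infty<1$ and $(I-B)^2=I-A_1$, where $T(b)$ is the Toeplitz part and $E_B$ the correction part of $B$. Put $Q=A_1+T(b)^2-2T(b)$ and let $\{X_k\}$ be the sequence generated by $$X_0=0,\qquad X_{k+1}=(2I-T(b)-X_k)^{-1}\bigl(Q+X_kT(b)\bigr),\quad k\ge 0.$$ Then $\{X_k\}$ converges to $E_B$ in the sense that $\lim_{k\to\infty}\|E_B-X_k\|_\infty=0$.
   Context: The Wiener algebra is $\mathcal W=\{a(z)=\sum_{i\in\mathbb Z}a_iz^i : |z|=1,\ \|a\|_{\mathcal W}:=\sum_{i\in\mathbb Z}|a_i|<\infty\}$. For $a\in\mathcal W$, $T(a)$ is the semi-infinite Toeplitz matrix with entries $(T(a))_{i,j}=a_{j-i}$, $i,j\in\mathbb Z^+=\{1,2,\dots\}$. Let $\mathcal K_d(\ell^\infty)$ be the set of infinite matrices $E=(e_{i,j})_{i,j\in\mathbb Z^+}$ (representing bounded operators on $\ell^\infty$) with $\lim_{i\to\infty}\sum_{j=1}^\infty|e_{i,j}|=0$. The class of quasi-Toeplitz matrices is $\mathcal{QT}_\infty=\{T(a)+E : a\in\mathcal W,\ E\in\mathcal K_d(\ell^\infty)\}$; it is a Banach algebra of bounded operators on $\ell^\infty$ with the norm $\|A\|_\infty=\sup_i\sum_{j=1}^\infty|a_{i,j}|$.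 For $A=T(a)+E\in\mathcal{QT}_\infty$, $T(a)$ is the Toeplitz part and $E$ the correction part of $A$. For an infinite matrix, $B\ge 0$ means that all entries are nonnegative; $I$ is the infinite identity matrix. It is known that if $A_1\in\mathcal{QT}_\infty$, $A_1\ge0$, $\|A_1\|_\infty<1$, there is a unique $B\in\mathcal{QT}_\infty$ with $B\ge 0$, $\|B\|_\infty<1$ and $(I-B)^2=I-A_1$. The iteration is well defined: each $2I-T(b)-X_k$ is invertible. *)

theory Defs
  imports "HOL-Analysis.Analysis" "HOL-Library.Function_Algebras"
begin

text \<open>
  The Wiener algebra consists of functions on the unit circle; a function
  \<open>complex \<Rightarrow> complex\<close> belongs to it according to its values on the circle only.
\<close>

definition wiener_expansion :: "(complex \<Rightarrow> complex) \<Rightarrow> (int \<Rightarrow> complex) \<Rightarrow> bool" where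
  "wiener_expansion a c \<longleftrightarrow>
     (\<lambda>i. norm (c i)) summable_on UNIV \<and>
     (\<forall>z. norm z = 1 \<longrightarrow> ((\<lambda>i. c i * z powi i) has_sum a z) UNIV)"

definition wiener :: "(complex \<Rightarrow> complex) set" where
  "wiener = {a. \<exists>c. wiener_expansion a c}"

definition wiener_coeff :: "(complex \<Rightarrow> complex) \<Rightarrow> int \<Rightarrow> complex" where
  "wiener_coeff a = (THE c. wiener_expansion a c)"

lemma has_integral_cis_int:
  "((\<lambda>t. cis (of_int m * t)) has_integral (if m = 0 then of_real (2 * pi) else 0)) {0..2 * pi}"
proof (cases "m = 0")
  case True
  then show ?thesis
    using has_integral_const_real[of "1::complex" 0 "2 * pi"] by (simp add: scaleR_conv_of_real)
next
  case False
  define g where "g = (\<lambda>t. cis (of_int m * t) / (\<i> * of_int m))"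
  have "(g has_vector_derivative cis (of_int m * t)) (at t within {0..2 * pi})" for t
  proof -
    have "((\<lambda>z. exp (\<i> * of_int m * z) / (\<i> * of_int m)) has_field_derivative
        exp (\<i> * of_int m * of_real t)) (at (of_real t))"
      using False by (auto intro!: derivative_eq_intros)
    from has_vector_derivative_real_field[OF this] show ?thesis
      by (simp add: g_def cis_conv_exp mult.assoc)
  qed
  then have "((\<lambda>t. cis (of_int m * t)) has_integral (g (2 * pi) - g 0)) {0..2 * pi}"
    by (intro fundamental_theorem_of_calculus) auto
  moreover have "cis (of_int m * (2 * pi)) = 1"
    using cis_multiple_2pi[of "of_int m"] by (simp add: mult_ac)
  ultimately show ?thesis
    using False by (simp add: g_def)
qed

lemma wiener_expansion_zero:
  assumes d: "(\<lambda>i. norm (d i)) summable_on (UNIV :: int set)"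
    and s: "\<And>z. norm z = 1 \<Longrightarrow> ((\<lambda>i. d i * z powi i) has_sum 0) UNIV"
  shows "d n = (0::complex)"
proof -
  have "norm (d n) \<le> e" if e: "e > 0" for e :: real
  proof -
    let ?S = "infsum (\<lambda>i. norm (d i)) UNIV"
    have "((\<lambda>i. norm (d i)) has_sum ?S) UNIV"
      using d by simp
    then obtain F0 where F0: "finite F0" "dist (sum (\<lambda>i. norm (d i)) F0) ?S \<le> e"
      using has_sum_finite_approximation e by blast
    define F where "F = insert n F0"
    have F: "finite F" "n \<in> F" using F0 by (auto simp: F_def)
    have "sum (\<lambda>i. norm (d i)) F0 \<le> sum (\<lambda>i. norm (d i)) F"
      using F0 by (intro sum_mono2) (auto simp: F_def)
    then have tail: "infsum (\<lambda>i. norm (d i)) (- F) \<le> e"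
      using F0(2) infsum_Diff[of "\<lambda>i. norm (d i)" UNIV F] d F
      by (auto simp: dist_real_def Compl_eq_Diff_UNIV)
    have dF: "(\<lambda>i. norm (d i)) summable_on (- F)"
      by (rule summable_on_subset_banach[OF d]) auto
    define p where "p = (\<lambda>t. \<Sum>i\<in>F. d i * cis (of_int (i - n) * t))"
    have bound: "norm (p t) \<le> e" for t
    proof -
      let ?f = "\<lambda>i. d i * cis t powi i"
      have sm: "(?f has_sum 0) UNIV" using s[of "cis t"] by simp
      have "(?f has_sum (0 - sum ?f F)) (UNIV - F)"
        using has_sum_Diff[OF sm has_sum_finite[OF F(1)]] by auto
      then have inf: "infsum ?f (- F) = - sum ?f F"
        by (simp add: infsumI Compl_eq_Diff_UNIV)
      have eq: "norm (?f i) = norm (d i)" for i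
        by (simp add: norm_mult norm_power_int)
      have "norm (sum ?f F) = norm (infsum ?f (- F))" by (simp add: inf)
      also have "\<dots> \<le> infsum (\<lambda>i. norm (?f i)) (- F)"
        by (rule norm_infsum_bound) (use dF eq in simp)
      also have "\<dots> \<le> e" using tail eq by simp
      finally have "norm (sum ?f F) \<le> e" .
      moreover have "p t = sum ?f F * cis t powi (- n)"
        unfolding p_def sum_distrib_right
        by (intro sum.cong refl)
           (simp add: cis_power_int cis_mult algebra_simps)
      ultimately show ?thesis
        by (simp add: norm_mult norm_power_int)
    qed
    have "(p has_integral (\<Sum>i\<in>F. d i * (if i - n = 0 then of_real (2 * pi) else 0))) {0..2 * pi}"
      unfolding p_def
      by (intro has_integral_sum F has_integral_mult_right has_integral_cis_int)
    moreover have "(\<Sum>i\<in>F. d i * (if i - n = 0 then of_real (2 * pi) else 0)) = d n * of_real (2 * pi)"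
      using F by (simp add: if_distrib cong: if_cong)
    ultimately have "(p has_integral d n * of_real (2 * pi)) {0..2 * pi}" by simp
    then have "norm (d n * of_real (2 * pi)) \<le> e * (2 * pi - 0)"
      using has_integral_bound_real[of e "{}" p "d n * of_real (2 * pi)" 0 "2 * pi"] bound e
      by simp
    then show ?thesis by (simp add: norm_mult)
  qed
  then have "norm (d n) \<le> 0" by (rule field_le_epsilon[of _ 0, simplified])
  then show ?thesis by simp
qed

lemma wiener_expansion_unique:
  assumes "wiener_expansion a c" "wiener_expansion a c'"
  shows "c = c'"
proof
  fix n
  have "(\<lambda>i. norm (c i - c' i)) summable_on UNIV"
  proof (rule summable_on_comparison_test)
    show "(\<lambda>i. norm (c i) + norm (c' i)) summable_on UNIV"
      using assms by (intro summable_on_add) (auto simp: wiener_expansion_def)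
  qed (auto intro: norm_triangle_ineq4)
  moreover have "((\<lambda>i. (c i - c' i) * z powi i) has_sum 0) UNIV" if "norm z = 1" for z
  proof -
    have "((\<lambda>i. c i * z powi i + - (c' i * z powi i)) has_sum (a z + - a z)) UNIV"
      using assms that unfolding wiener_expansion_def
      by (intro has_sum_add) (auto simp: has_sum_uminus)
    then show ?thesis by (simp add: algebra_simps)
  qed
  ultimately have "c n - c' n = 0" by (rule wiener_expansion_zero)
  then show "c n = c' n" by simp
qed

lemma wiener_coeff_eqI: "wiener_expansion a c \<Longrightarrow> wiener_coeff a = c"
  unfolding wiener_coeff_def by (blast intro: wiener_expansion_unique)


text \<open>
  Rows and columns are indexed by \<open>nat\<close>, that is from 0 instead of from 1; Toeplitz matrices
  depend on index differences only, so the shift is immaterial.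
  Sum, difference and zero of matrices are the entrywise ones of
  \<^theory>\<open>HOL-Library.Function_Algebras\<close>; the entrywise \<open>*\<close>, \<open>1\<close> and numerals
  provided there are not the matrix operations and are not used.
\<close>

type_synonym infmat = "nat \<Rightarrow> nat \<Rightarrow> complex"

definition infmat_id :: infmat where
  "infmat_id = (\<lambda>i j. if i = j then 1 else 0)"

definition infmat_scale :: "complex \<Rightarrow> infmat \<Rightarrow> infmat" (infixr "*\<^sub>m" 75) where
  "c *\<^sub>m A = (\<lambda>i j. c * A i j)"

definition infmat_mult :: "infmat \<Rightarrow> infmat \<Rightarrow> infmat" (infixl "**\<^sub>m" 70) where
  "A **\<^sub>m B = (\<lambda>i j. \<Sum>k. A i k * B k j)"

definition infmat_nonneg :: "infmat \<Rightarrow> bool" where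
  "infmat_nonneg A \<longleftrightarrow> (\<forall>i j. A i j \<in> \<real>\<^sub>\<ge>\<^sub>0)"

definition linf_norm :: "infmat \<Rightarrow> ennreal" where
  "linf_norm A = (SUP i. \<Sum>j. ennreal (norm (A i j)))"

definition linf_bounded :: "infmat \<Rightarrow> bool" where
  "linf_bounded A \<longleftrightarrow>
     (\<exists>K. \<forall>x r. (\<forall>j. norm (x j) \<le> r) \<longrightarrow>
        (\<forall>i. summable (\<lambda>j. A i j * x j) \<and> norm (\<Sum>j. A i j * x j) \<le> K * r))"

lemma linf_bounded_iff_norm: "linf_bounded A \<longleftrightarrow> linf_norm A < \<infinity>"
proof
  assume "linf_bounded A"
  then obtain K where K: "\<forall>x r. (\<forall>j. norm (x j) \<le> r) \<longrightarrow>
      (\<forall>i. summable (\<lambda>j. A i j * x j) \<and> norm (\<Sum>j. A i j * x j) \<le> K * r)"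
    unfolding linf_bounded_def by blast
  have "(\<Sum>j. ennreal (norm (A i j))) \<le> ennreal K" for i
  proof -
    define x where "x j = cnj (sgn (A i j))" for j
    have x: "A i j * x j = of_real (norm (A i j))" for j
    proof (cases "A i j = 0")
      case False
      have "A i j * x j = A i j * cnj (A i j) / of_real (norm (A i j))"
        by (simp add: x_def sgn_eq)
      also have "\<dots> = of_real (norm (A i j))"
        using False by (simp only: complex_norm_square[symmetric]) (simp add: power2_eq_square)
      finally show ?thesis .
    qed simp
    have "norm (x j) \<le> 1" for j by (simp add: x_def norm_sgn)
    with K have "summable (\<lambda>j. A i j * x j) \<and> norm (\<Sum>j. A i j * x j) \<le> K * 1" by blast
    then have *: "summable (\<lambda>j. complex_of_real (norm (A i j)))"
      "norm (\<Sum>j. complex_of_real (norm (A i j))) \<le> K" by (simp_all add: x)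
    then have s: "summable (\<lambda>j. norm (A i j))" by (simp add: summable_of_real_iff)
    then have "(\<Sum>j. norm (A i j)) \<le> K"
      using *(2) by (simp add: suminf_of_real[symmetric] suminf_nonneg)
    then show ?thesis
      using s by (simp add: suminf_ennreal2 ennreal_leI)
  qed
  then have "linf_norm A \<le> ennreal K" unfolding linf_norm_def by (rule SUP_least)
  also have "ennreal K < \<infinity>" by simp
  finally show "linf_norm A < \<infinity>" .
next
  assume fin: "linf_norm A < \<infinity>"
  define K where "K = enn2real (linf_norm A)"
  have K: "linf_norm A = ennreal K" "K \<ge> 0" using fin by (simp_all add: K_def)
  have row: "summable (\<lambda>j. norm (A i j))" "(\<Sum>j. norm (A i j)) \<le> K" for i
  proof -
    have le: "(\<Sum>j. ennreal (norm (A i j))) \<le> ennreal K"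
      unfolding K(1)[symmetric] linf_norm_def by (rule SUP_upper) simp
    then have "(\<Sum>j. ennreal (norm (A i j))) \<noteq> top" by (auto simp: top_unique)
    then show s: "summable (\<lambda>j. norm (A i j))"
      by (intro summable_suminf_not_top) auto
    show "(\<Sum>j. norm (A i j)) \<le> K"
      using le s K(2) by (simp add: suminf_ennreal2)
  qed
  have "summable (\<lambda>j. A i j * x j) \<and> norm (\<Sum>j. A i j * x j) \<le> K * r"
    if x: "\<forall>j. norm (x j) \<le> r" for x r i
  proof -
    have r: "r \<ge> 0" using x norm_ge_zero order_trans by blast
    have le: "norm (A i j * x j) \<le> norm (A i j) * r" for j
      using x by (simp add: norm_mult mult_left_mono)
    have s: "summable (\<lambda>j. norm (A i j * x j))"
      by (rule summable_comparison_test'[of "\<lambda>j. norm (A i j) * r" 0])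
         (use row(1) le in \<open>auto intro: summable_mult2\<close>)
    have "norm (\<Sum>j. A i j * x j) \<le> (\<Sum>j. norm (A i j * x j))"
      by (rule summable_norm[OF s])
    also have "\<dots> \<le> (\<Sum>j. norm (A i j) * r)"
      by (intro suminf_le le s summable_mult2 row)
    also have "\<dots> \<le> K * r"
      using row r by (simp add: suminf_mult2[symmetric] mult_right_mono)
    finally show ?thesis using summable_norm_cancel[OF s] by blast
  qed
  then show "linf_bounded A" unfolding linf_bounded_def by blast
qed

definition toeplitz :: "(complex \<Rightarrow> complex) \<Rightarrow> infmat" where
  "toeplitz a = (\<lambda>i j. wiener_coeff a (int j - int i))"

definition Kd_linf :: "infmat set" where
  "Kd_linf = {E. linf_bounded E \<and> (\<lambda>i. \<Sum>j. norm (E i j)) \<longlonglongrightarrow> 0}"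

definition QT_linf :: "infmat set" where
  "QT_linf = {toeplitz a + E | a E. a \<in> wiener \<and> E \<in> Kd_linf}"

text \<open>
  Inverse among the matrices of bounded operators, where multiplication is associative and
  two-sided inverses are unique; unspecified if there is no such inverse.
\<close>

definition infmat_inv :: "infmat \<Rightarrow> infmat" where
  "infmat_inv A =
     (THE C. linf_bounded C \<and> A **\<^sub>m C = infmat_id \<and> C **\<^sub>m A = infmat_id)"

end

theory Submission
  imports Defs
begin

text \<open>
  Put \<open>Y k = T(b) + X k\<close>. The iteration becomes \<open>(2I - Y k) Y (k+1) = A1\<close>, of which \<open>B\<close> is a fixed
  point, so that \<open>B - Y (k+1) = (2I - Y k)\<^sup>-\<^sup>1 (B - Y k) B\<close>. Entries far down the diagonals of \<open>B\<close>
  approach those of \<open>T(b)\<close>, hence the norm of \<open>Y 0 = T(b)\<close> is at most that of \<open>B\<close>. Inductively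
  \<open>Y k\<close> has norm at most 1, the inverse exists and has norm at most 1 by the Neumann series, and the
  error shrinks by the factor \<open>\<parallel>B\<parallel> < 1\<close> in each step.
\<close>

section \<open>Interchange of absolutely convergent double series\<close>

lemma suminf_eq_infsum:
  fixes f :: "nat \<Rightarrow> 'a::banach"
  assumes "summable (\<lambda>n. norm (f n))"
  shows "suminf f = infsum f UNIV"
  using norm_summable_imp_has_sum[OF assms summable_sums[OF summable_norm_cancel[OF assms]]]
  by (simp add: infsumI)

text \<open>The summable bound \<open>g\<close> on the absolute row sums makes the family absolutely
  summable over all index pairs. Fubini for unordered sums then applies, and the results are carried
  back to ordered series, the form in which matrix products are defined.\<close>

lemma suminf_swap:
  fixes f :: "nat \<Rightarrow> nat \<Rightarrow> 'a::banach"
  assumes row: "\<And>i. summable (\<lambda>j. norm (f i j))" "\<And>i. (\<Sum>j. norm (f i j)) \<le> g i"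
    and g: "summable g"
  shows "(\<Sum>i. \<Sum>j. f i j) = (\<Sum>j. \<Sum>i. f i j)"
    and "\<And>j. summable (\<lambda>i. norm (f i j))"
    and "summable (\<lambda>j. norm (\<Sum>i. f i j))"
proof -
  have r: "infsum (\<lambda>j. norm (f i j)) UNIV = (\<Sum>j. norm (f i j))" for i
    using suminf_eq_infsum[of "\<lambda>j. norm (f i j)"] row by simp
  have sr: "summable (\<lambda>i. norm (\<Sum>j. norm (f i j)))"
    by (rule summable_comparison_test'[OF g, of 0]) (use row in \<open>auto simp: suminf_nonneg\<close>)
  have abs: "(\<lambda>(i, j). f i j) abs_summable_on UNIV \<times> UNIV"
    using row sr
    by (intro Infinite_Sum.abs_summable_on_Sigma_iff[THEN iffD2])
       (auto simp: r intro!: norm_summable_imp_summable_on)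
  then have sum: "(\<lambda>(i, j). f i j) summable_on UNIV \<times> UNIV"
    by (rule abs_summable_summable)
  \<comment> \<open>Swapping the coordinates keeps absolute summability; reading the family column
    by column yields the claims about columns.\<close>
  have "(\<lambda>(j, i). f i j) abs_summable_on UNIV \<times> UNIV"
    using abs summable_on_reindex[of prod.swap "UNIV \<times> UNIV" "\<lambda>(i, j). norm (f i j)"]
    by (simp add: o_def case_prod_unfold product_swap)
  then have col: "(\<lambda>i. norm (f i j)) summable_on UNIV"
    and cols: "(\<lambda>j. infsum (\<lambda>i. norm (f i j)) UNIV) summable_on UNIV" for j
    unfolding Infinite_Sum.abs_summable_on_Sigma_iff
    by (auto simp: infsum_nonneg)
  show col': "summable (\<lambda>i. norm (f i j))" for j
    using col[of j] by (auto simp: summable_on_def dest: has_sum_imp_sums sums_summable)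
  have "summable (\<lambda>j. infsum (\<lambda>i. norm (f i j)) UNIV)"
    using cols by (auto simp: summable_on_def dest: has_sum_imp_sums sums_summable)
  then have "summable (\<lambda>j. \<Sum>i. norm (f i j))"
    using suminf_eq_infsum[of "\<lambda>i. norm (f i _)"] col' by simp
  then show s: "summable (\<lambda>j. norm (\<Sum>i. f i j))"
    by (rule summable_comparison_test'[of _ 0]) (use col' in \<open>auto intro: summable_norm\<close>)
  have "summable (\<lambda>i. norm (\<Sum>j. f i j))"
    by (rule summable_comparison_test'[OF sr, of 0])
       (use row in \<open>auto intro!: summable_norm order_trans[OF summable_norm]\<close>)
  then show "(\<Sum>i. \<Sum>j. f i j) = (\<Sum>j. \<Sum>i. f i j)"
    using infsum_swap_banach[OF sum] s row col' by (simp add: suminf_eq_infsum)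
qed

text \<open>Triangle inequality for an infinite sum of absolutely summable sequences: pull the norm
  inside each column, then interchange the sums of norms. It bounds the rows of matrix products and
  of the Neumann series.\<close>

lemma suminf_swap_norm:
  fixes f :: "nat \<Rightarrow> nat \<Rightarrow> 'a::banach"
  assumes row: "\<And>i. summable (\<lambda>j. norm (f i j))" "\<And>i. (\<Sum>j. norm (f i j)) \<le> g i"
    and g: "summable g"
  shows "summable (\<lambda>j. norm (\<Sum>i. f i j))"
    and "(\<Sum>j. norm (\<Sum>i. f i j)) \<le> suminf g"
proof -
  note n = suminf_swap[of "\<lambda>i j. norm (f i j)", simplified, OF row g]
  show s: "summable (\<lambda>j. norm (\<Sum>i. f i j))"
    by (rule suminf_swap(3)[OF row g])
  have pos: "0 \<le> (\<Sum>i. norm (f i j))" "0 \<le> (\<Sum>i. norm (f j i))" for j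
    using n(2) row by (auto intro: suminf_nonneg)
  have "(\<Sum>j. norm (\<Sum>i. f i j)) \<le> (\<Sum>j. \<Sum>i. norm (f i j))"
    using n pos by (intro suminf_le s summable_norm) auto
  also have "\<dots> = (\<Sum>i. \<Sum>j. norm (f i j))"
    using n(1) by simp
  also have "\<dots> \<le> suminf g"
    by (intro suminf_le row g summable_comparison_test'[OF g, of 0]) (use row pos in auto)
  finally show "(\<Sum>j. norm (\<Sum>i. f i j)) \<le> suminf g" .
qed

section \<open>Bounded matrices through uniform bounds on absolute row sums\<close>

text \<open>A real-valued form of a bound on \<open>linf_norm\<close>: it makes the summability of
  rows explicit and spares arithmetic in \<open>ennreal\<close>. \<open>K\<close> is any upper
  bound, not necessarily the least.\<close>

definition rows_le :: "infmat \<Rightarrow> real \<Rightarrow> bool" where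
  "rows_le A K \<longleftrightarrow> (\<forall>i. summable (\<lambda>j. norm (A i j)) \<and> (\<Sum>j. norm (A i j)) \<le> K)"

lemma rows_leI:
  assumes "\<And>i. summable (\<lambda>j. norm (A i j))" "\<And>i. (\<Sum>j. norm (A i j)) \<le> K"
  shows "rows_le A K"
  using assms by (simp add: rows_le_def)

lemma rows_leD:
  assumes "rows_le A K"
  shows "summable (\<lambda>j. norm (A i j))" "(\<Sum>j. norm (A i j)) \<le> K"
  using assms by (auto simp: rows_le_def)

lemma rows_le_nonneg: "rows_le A K \<Longrightarrow> 0 \<le> K"
  using rows_leD[of A K 0] suminf_nonneg[of "\<lambda>j. norm (A 0 j)"] by simp

lemma rows_le_entry:
  assumes "rows_le A K"
  shows "norm (A i j) \<le> K"
proof -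
  have "norm (A i j) \<le> (\<Sum>j. norm (A i j))"
    using sum_le_suminf[OF rows_leD(1)[OF assms], of "{j}" i] by simp
  then show ?thesis
    using rows_leD(2)[OF assms, of i] by simp
qed

lemma rows_le_mono: "rows_le A K \<Longrightarrow> K \<le> L \<Longrightarrow> rows_le A L"
  unfolding rows_le_def by (meson order_trans)

text \<open>The sign condition matters because \<open>ennreal\<close> sends negative reals to 0: for
  negative \<open>K\<close> the zero matrix would satisfy the left side but not the right.\<close>

lemma linf_norm_le_iff:
  assumes "0 \<le> K"
  shows "linf_norm A \<le> ennreal K \<longleftrightarrow> rows_le A K"
proof
  assume le: "linf_norm A \<le> ennreal K"
  show "rows_le A K"
  proof (rule rows_leI)
    fix i
    have le: "(\<Sum>j. ennreal (norm (A i j))) \<le> ennreal K"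
      using le unfolding linf_norm_def SUP_le_iff by blast
    then have "(\<Sum>j. ennreal (norm (A i j))) \<noteq> top" by (auto simp: top_unique)
    then show s: "summable (\<lambda>j. norm (A i j))"
      by (intro summable_suminf_not_top) auto
    show "(\<Sum>j. norm (A i j)) \<le> K"
      using le s assms by (simp add: suminf_ennreal2)
  qed
next
  assume "rows_le A K"
  from rows_leD[OF this] show "linf_norm A \<le> ennreal K"
    unfolding linf_norm_def by (intro SUP_least) (simp add: suminf_ennreal2 ennreal_leI)
qed

text \<open>The norm itself, read as a real number, is the witness. Applied to \<open>B\<close>,
  this supplies the contraction factor of the error estimate.\<close>

lemma linf_norm_less_oneE:
  assumes "linf_norm A < 1"
  obtains K where "0 \<le> K" "K < 1" "rows_le A K"
proof
  have fin: "linf_norm A < top" using assms by (rule less_trans) simp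
  show "0 \<le> enn2real (linf_norm A)" by simp
  show "enn2real (linf_norm A) < 1"
    using assms fin by (metis enn2real_1 enn2real_less_iff ennreal_1 enn2real_nonneg ennreal_enn2real ennreal_less_iff)
  show "rows_le A (enn2real (linf_norm A))"
    using fin by (subst linf_norm_le_iff[symmetric]) auto
qed

lemma linf_bounded_iff_rows_le: "linf_bounded A \<longleftrightarrow> (\<exists>K. rows_le A K)"
proof
  assume "linf_bounded A"
  then have "linf_norm A \<le> ennreal (enn2real (linf_norm A))"
    by (simp add: linf_bounded_iff_norm)
  then show "\<exists>K. rows_le A K"
    by (subst (asm) linf_norm_le_iff) auto
next
  assume "\<exists>K. rows_le A K"
  then obtain K where "rows_le A K" ..
  then have "linf_norm A \<le> ennreal K"
    by (simp add: linf_norm_le_iff rows_le_nonneg)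
  then show "linf_bounded A"
    unfolding linf_bounded_iff_norm by (rule le_less_trans) simp
qed

section \<open>Norm estimates and ring laws for bounded matrices\<close>

lemma rows_le_id: "rows_le infmat_id 1"
proof (rule rows_leI)
  fix i
  have "(\<lambda>j. norm (infmat_id i j)) sums 1"
    using sums_single[of i "\<lambda>_. 1::real"]
    by (auto simp: infmat_id_def if_distrib eq_commute cong: if_cong)
  then show "summable (\<lambda>j. norm (infmat_id i j))" "(\<Sum>j. norm (infmat_id i j)) \<le> 1"
    by (auto simp: sums_iff)
qed

lemma rows_le_add:
  assumes A: "rows_le A K" and B: "rows_le B L"
  shows "rows_le (A + B) (K + L)"
proof (rule rows_leI)
  fix i
  note s = summable_add[OF rows_leD(1)[OF A, of i] rows_leD(1)[OF B, of i]]
  show s': "summable (\<lambda>j. norm ((A + B) i j))"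
    by (rule summable_comparison_test'[OF s, of 0]) (simp add: norm_triangle_ineq)
  have "(\<Sum>j. norm ((A + B) i j)) \<le> (\<Sum>j. norm (A i j) + norm (B i j))"
    by (intro suminf_le s s') (simp add: norm_triangle_ineq)
  also have "\<dots> \<le> K + L"
    using suminf_add[OF rows_leD(1)[OF A, of i] rows_leD(1)[OF B, of i]]
      rows_leD(2)[OF A, of i] rows_leD(2)[OF B, of i] by simp
  finally show "(\<Sum>j. norm ((A + B) i j)) \<le> K + L" .
qed

lemma rows_le_scale:
  assumes "rows_le A K"
  shows "rows_le (c *\<^sub>m A) (norm c * K)"
  using rows_leD[OF assms]
  by (intro rows_leI)
     (auto simp: infmat_scale_def norm_mult suminf_mult intro: summable_mult mult_left_mono)

lemma rows_le_diff:
  assumes "rows_le A K" "rows_le B L"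
  shows "rows_le (A - B) (K + L)"
proof -
  have "A - B = A + (-1) *\<^sub>m B" by (auto simp: infmat_scale_def fun_eq_iff)
  then show ?thesis using rows_le_add[OF assms(1) rows_le_scale[OF assms(2), of "-1"]] by (simp only:) simp
qed

lemma infmat_mult_summable:
  assumes A: "rows_le A K" and B: "rows_le B L"
  shows "summable (\<lambda>k. norm (A i k * B k j))"
proof (rule summable_comparison_test'[of _ 0])
  show "summable (\<lambda>k. norm (A i k) * L)"
    using rows_leD[OF A] by (intro summable_mult2)
  show "norm (norm (A i k * B k j)) \<le> norm (A i k) * L" for k
    using rows_le_entry[OF B] by (simp add: norm_mult mult_left_mono)
qed

text \<open>Row \<open>i\<close> of the product is the combination of the rows of \<open>B\<close>
  with coefficients \<open>A i k\<close>, so its absolute sum is at most the sum over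
  \<open>k\<close> of \<open>norm (A i k) * L\<close>.\<close>

lemma rows_le_mult:
  assumes A: "rows_le A K" and B: "rows_le B L"
  shows "rows_le (A **\<^sub>m B) (K * L)"
proof (rule rows_leI)
  fix i
  define f where "f k j = A i k * B k j" for k j
  have f: "summable (\<lambda>j. norm (f k j))" "(\<Sum>j. norm (f k j)) \<le> norm (A i k) * L" for k
    using rows_leD[OF B, of k]
    by (auto simp: f_def norm_mult suminf_mult intro: summable_mult mult_left_mono)
  note s = suminf_swap_norm[OF f summable_mult2[OF rows_leD(1)[OF A]]]
  show "summable (\<lambda>j. norm ((A **\<^sub>m B) i j))"
    using s(1) by (simp add: f_def infmat_mult_def)
  have "(\<Sum>j. norm ((A **\<^sub>m B) i j)) \<le> (\<Sum>k. norm (A i k) * L)"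
    using s(2) by (simp add: f_def infmat_mult_def)
  also have "\<dots> \<le> K * L"
    using rows_leD[OF A, of i] rows_le_nonneg[OF B]
    by (simp add: suminf_mult2[symmetric] mult_right_mono)
  finally show "(\<Sum>j. norm ((A **\<^sub>m B) i j)) \<le> K * L" .
qed

text \<open>The two sides sum the same triple products in opposite orders. Bounds on the entries of
  \<open>C\<close> and on the row sums of \<open>B\<close>, together with the summable rows of
  \<open>A\<close>, make this double series absolutely convergent. For arbitrary infinite matrices
  associativity can fail.\<close>

lemma infmat_mult_assoc:
  assumes A: "rows_le A K" and B: "rows_le B L" and C: "rows_le C M"
  shows "(A **\<^sub>m B) **\<^sub>m C = A **\<^sub>m (B **\<^sub>m C)"
proof (intro ext)
  fix i j
  define f where "f k l = A i k * B k l * C l j" for k l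
  have le: "norm (f k l) \<le> norm (A i k) * M * norm (B k l)" for k l
    using mult_left_mono[OF rows_le_entry[OF C, of l j], of "norm (A i k) * norm (B k l)"]
    by (simp add: f_def norm_mult mult_ac)
  have sB: "summable (\<lambda>l. norm (A i k) * M * norm (B k l))" for k
    by (intro summable_mult rows_leD(1)[OF B])
  have f: "summable (\<lambda>l. norm (f k l))" for k
    by (rule summable_comparison_test'[OF sB, of 0]) (use le in simp)
  have "(\<Sum>l. norm (f k l)) \<le> (\<Sum>l. norm (A i k) * M * norm (B k l))" for k
    by (intro suminf_le le f sB)
  also have "\<dots> k \<le> norm (A i k) * M * L" for k
    using rows_leD[OF B, of k] rows_le_nonneg[OF C] by (simp add: suminf_mult mult_left_mono)
  finally have f': "(\<Sum>l. norm (f k l)) \<le> norm (A i k) * M * L" for k .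
  have "summable (\<lambda>k. norm (A i k) * M * L)"
    by (intro summable_mult2 rows_leD(1)[OF A])
  from suminf_swap(1)[OF f f' this]
  have "(\<Sum>k. \<Sum>l. f k l) = (\<Sum>l. \<Sum>k. f k l)" .
  moreover have "(\<Sum>l. f k l) = A i k * (\<Sum>l. B k l * C l j)" for k
    unfolding f_def mult.assoc
    by (intro suminf_mult summable_norm_cancel[OF infmat_mult_summable[OF B C]])
  moreover have "(\<Sum>k. f k l) = (\<Sum>k. A i k * B k l) * C l j" for l
    unfolding f_def
    by (intro suminf_mult2[symmetric] summable_norm_cancel[OF infmat_mult_summable[OF A B]])
  ultimately show "((A **\<^sub>m B) **\<^sub>m C) i j = (A **\<^sub>m (B **\<^sub>m C)) i j"
    by (simp add: infmat_mult_def)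
qed

lemma infmat_mult_id_left [simp]: "infmat_id **\<^sub>m A = A"
proof (intro ext)
  fix i j
  have "(\<lambda>k. infmat_id i k * A k j) sums A i j"
    using sums_single[of i "\<lambda>k. A k j"]
    by (auto simp: infmat_id_def if_distrib if_distribR eq_commute cong: if_cong)
  then show "(infmat_id **\<^sub>m A) i j = A i j"
    by (simp add: infmat_mult_def sums_iff)
qed

lemma infmat_mult_id_right [simp]: "A **\<^sub>m infmat_id = A"
proof (intro ext)
  fix i j
  have "(\<lambda>k. A i k * infmat_id k j) sums A i j"
    using sums_single[of j "\<lambda>k. A i k"]
    by (auto simp: infmat_id_def if_distrib if_distribR cong: if_cong)
  then show "(A **\<^sub>m infmat_id) i j = A i j"
    by (simp add: infmat_mult_def sums_iff)
qed

lemma infmat_mult_diff_right: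
  assumes "rows_le A K" "rows_le B L" "rows_le C M"
  shows "A **\<^sub>m (B - C) = A **\<^sub>m B - A **\<^sub>m C"
  using summable_norm_cancel[OF infmat_mult_summable[OF assms(1,2)]]
    summable_norm_cancel[OF infmat_mult_summable[OF assms(1,3)]]
  by (auto simp: infmat_mult_def fun_eq_iff right_diff_distrib suminf_diff)

lemma infmat_mult_diff_left:
  assumes "rows_le A K" "rows_le B L" "rows_le C M"
  shows "(A - B) **\<^sub>m C = A **\<^sub>m C - B **\<^sub>m C"
  using summable_norm_cancel[OF infmat_mult_summable[OF assms(1,3)]]
    summable_norm_cancel[OF infmat_mult_summable[OF assms(2,3)]]
  by (auto simp: infmat_mult_def fun_eq_iff left_diff_distrib suminf_diff)

lemma infmat_scale_mult:
  assumes "rows_le A K" "rows_le B L"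
  shows "(c *\<^sub>m A) **\<^sub>m B = c *\<^sub>m (A **\<^sub>m B)" "A **\<^sub>m (c *\<^sub>m B) = c *\<^sub>m (A **\<^sub>m B)"
  using summable_norm_cancel[OF infmat_mult_summable[OF assms]]
  by (auto simp: infmat_mult_def infmat_scale_def fun_eq_iff mult.assoc mult.left_commute[of _ c]
      suminf_mult)

section \<open>Inverses and the Neumann series\<close>

text \<open>A bounded two-sided inverse \<open>D\<close> satisfies
  \<open>D = D (A C) = (D A) C = C\<close>, where boundedness of all three factors permits
  reassociation. Hence the definite description denotes \<open>C\<close>.\<close>

lemma infmat_inv_eqI:
  assumes "rows_le A K" "rows_le C L" "A **\<^sub>m C = infmat_id" "C **\<^sub>m A = infmat_id"
  shows "infmat_inv A = C"
  unfolding infmat_inv_def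
proof (rule the_equality)
  show "linf_bounded C \<and> A **\<^sub>m C = infmat_id \<and> C **\<^sub>m A = infmat_id"
    using assms by (auto simp: linf_bounded_iff_rows_le)
next
  fix D assume D: "linf_bounded D \<and> A **\<^sub>m D = infmat_id \<and> D **\<^sub>m A = infmat_id"
  then obtain M where M: "rows_le D M" by (auto simp: linf_bounded_iff_rows_le)
  have "D = D **\<^sub>m (A **\<^sub>m C)" by (simp add: assms)
  also have "\<dots> = (D **\<^sub>m A) **\<^sub>m C"
    using infmat_mult_assoc[OF M assms(1,2)] by simp
  finally show "D = C" using D by simp
qed

primrec infmat_power :: "infmat \<Rightarrow> nat \<Rightarrow> infmat" where
  "infmat_power A 0 = infmat_id"
| "infmat_power A (Suc n) = infmat_power A n **\<^sub>m A"

lemma rows_le_power: "rows_le A q \<Longrightarrow> rows_le (infmat_power A n) (q ^ n)"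
proof (induction n)
  case (Suc n)
  then show ?case using rows_le_mult[of "infmat_power A n" "q ^ n" A q] by (simp add: mult.commute)
qed (simp add: rows_le_id)

text \<open>Powers grow by multiplication on the right; this form is needed to see that the Neumann
  series inverts from both sides.\<close>

lemma infmat_power_Suc_left:
  assumes "rows_le A q"
  shows "infmat_power A (Suc n) = A **\<^sub>m infmat_power A n"
proof (induction n)
  case (Suc n)
  then show ?case
    using infmat_mult_assoc[OF assms rows_le_power[OF assms] assms, of n] by simp
qed simp

text \<open>\<open>S\<close> is the entrywise sum of all powers of \<open>A\<close>. The bound
  \<open>q ^ n\<close> on the \<open>n\<close>-th power gives the geometric bound on
  \<open>S\<close> and permits summing in either order, so that
  \<open>A S = S A = S - I\<close>.\<close>

lemma infmat_neumann:
  assumes A: "rows_le A q" and q: "q < 1"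
  obtains S where "rows_le S (1 / (1 - q))"
    "(infmat_id - A) **\<^sub>m S = infmat_id" "S **\<^sub>m (infmat_id - A) = infmat_id"
proof
  define P where "P = infmat_power A"
  define S :: infmat where "S i j = (\<Sum>n. P n i j)" for i j
  have q0: "0 \<le> q" using rows_le_nonneg[OF A] .
  note P = rows_le_power[OF A, folded P_def]
  have geo: "summable (\<lambda>n. q ^ n)" using q q0 by (simp add: summable_geometric)
  have sP: "summable (\<lambda>n. norm (P n i j))" for i j
    using rows_le_entry[OF P] by (intro summable_comparison_test'[OF geo, of 0]) simp
  have sP': "summable (\<lambda>n. P n i j)" for i j
    using sP by (rule summable_norm_cancel)
  \<comment> \<open>The term for \<open>n = 0\<close>, which the shifted series omits, is the
    identity.\<close>
  have shift: "(\<Sum>n. P (Suc n) i j) = (S - infmat_id) i j" for i j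
    using suminf_split_head[OF sP'[of i j]] by (simp add: S_def P_def)
  show S: "rows_le S (1 / (1 - q))"
  proof (rule rows_leI)
    fix i
    show "summable (\<lambda>j. norm (S i j))" "(\<Sum>j. norm (S i j)) \<le> 1 / (1 - q)"
      using suminf_swap_norm[of "\<lambda>n j. P n i j", OF rows_leD[OF P] geo] q q0
      by (simp_all add: S_def suminf_geometric)
  qed
  have "(S **\<^sub>m A) i j = (S - infmat_id) i j" for i j
  proof -
    have f: "summable (\<lambda>k. norm (P n i k * A k j))" for n
      by (rule infmat_mult_summable[OF P A])
    have le: "norm (P n i k * A k j) \<le> norm (P n i k) * q" for n k
      using rows_le_entry[OF A] by (simp add: norm_mult mult_left_mono)
    have sq: "summable (\<lambda>k. norm (P n i k) * q)" for n
      by (intro summable_mult2 rows_leD(1)[OF P])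
    have "(\<Sum>k. norm (P n i k * A k j)) \<le> (\<Sum>k. norm (P n i k) * q)" for n
      by (intro suminf_le le f sq)
    also have "\<dots> n \<le> q ^ n * q" for n
      using rows_leD[OF P, of n i] q0 by (simp add: suminf_mult2[symmetric] mult_right_mono)
    finally have f': "(\<Sum>k. norm (P n i k * A k j)) \<le> q ^ n * q" for n .
    have "(S **\<^sub>m A) i j = (\<Sum>k. \<Sum>n. P n i k * A k j)"
      by (simp add: infmat_mult_def S_def suminf_mult2[OF sP'])
    also have "\<dots> = (\<Sum>n. \<Sum>k. P n i k * A k j)"
      by (rule suminf_swap(1)[OF f f' summable_mult2[OF geo], symmetric])
    also have "\<dots> = (\<Sum>n. P (Suc n) i j)"
      by (simp add: P_def infmat_mult_def)
    finally show ?thesis using shift by simp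
  qed
  then have SA: "S **\<^sub>m A = S - infmat_id" by (intro ext)
  have "(A **\<^sub>m S) i j = (S - infmat_id) i j" for i j
  proof -
    have f: "summable (\<lambda>k. norm (A i k * P n k j))" for n
      by (rule infmat_mult_summable[OF A P])
    have le: "norm (A i k * P n k j) \<le> norm (A i k) * q ^ n" for n k
      using rows_le_entry[OF P] by (simp add: norm_mult mult_left_mono)
    have sq: "summable (\<lambda>k. norm (A i k) * q ^ n)" for n
      by (intro summable_mult2 rows_leD(1)[OF A])
    have "(\<Sum>k. norm (A i k * P n k j)) \<le> (\<Sum>k. norm (A i k) * q ^ n)" for n
      by (intro suminf_le le f sq)
    also have "\<dots> n \<le> q * q ^ n" for n
      using rows_leD[OF A, of i] q0 by (simp add: suminf_mult2[symmetric] mult_right_mono)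
    finally have f': "(\<Sum>k. norm (A i k * P n k j)) \<le> q * q ^ n" for n .
    have "(A **\<^sub>m S) i j = (\<Sum>k. \<Sum>n. A i k * P n k j)"
      by (simp add: infmat_mult_def S_def suminf_mult[OF sP'])
    also have "\<dots> = (\<Sum>n. \<Sum>k. A i k * P n k j)"
      by (rule suminf_swap(1)[OF f f' summable_mult[OF geo], symmetric])
    also have "\<dots> = (\<Sum>n. P (Suc n) i j)"
      unfolding P_def infmat_power_Suc_left[OF A] by (simp add: infmat_mult_def)
    finally show ?thesis using shift by simp
  qed
  then have AS: "A **\<^sub>m S = S - infmat_id" by (intro ext)
  show "(infmat_id - A) **\<^sub>m S = infmat_id"
    using infmat_mult_diff_left[OF rows_le_id A S] AS by simp
  show "S **\<^sub>m (infmat_id - A) = infmat_id"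
    using infmat_mult_diff_right[OF S rows_le_id A] SA by simp
qed

text \<open>Factor \<open>2I - Y = 2 (I - Y/2)\<close>. Since \<open>Y/2\<close> has bound 1/2, its
  Neumann series has bound 2, and dividing by the outer factor 2 gives bound 1. This value lets the
  iterates stay bounded by 1 and does not spoil the contraction.\<close>

lemma infmat_inv_two_minus:
  assumes Y: "rows_le Y 1"
  shows "rows_le (infmat_inv (2 *\<^sub>m infmat_id - Y)) 1"
    "infmat_inv (2 *\<^sub>m infmat_id - Y) **\<^sub>m (2 *\<^sub>m infmat_id - Y) = infmat_id"
proof -
  define Z where "Z = infmat_id - (1/2) *\<^sub>m Y"
  have hY: "rows_le ((1/2) *\<^sub>m Y) (1/2)" using rows_le_scale[OF Y, of "1/2"] by simp
  then obtain S where S: "rows_le S (1 / (1 - 1/2))" "Z **\<^sub>m S = infmat_id" "S **\<^sub>m Z = infmat_id"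
    unfolding Z_def by (rule infmat_neumann) auto
  have Z: "rows_le Z (1 + 1/2)"
    unfolding Z_def by (intro rows_le_diff rows_le_id hY)
  have eq: "2 *\<^sub>m infmat_id - Y = 2 *\<^sub>m Z"
    by (auto simp: Z_def infmat_scale_def fun_eq_iff algebra_simps)
  define C where "C = (1/2) *\<^sub>m S"
  have C: "rows_le C 1" using rows_le_scale[OF S(1), of "1/2"] by (simp add: C_def)
  have "(2 *\<^sub>m Z) **\<^sub>m C = infmat_id" "C **\<^sub>m (2 *\<^sub>m Z) = infmat_id"
    unfolding infmat_scale_mult[OF Z C] infmat_scale_mult[OF C Z] unfolding C_def
      infmat_scale_mult[OF Z S(1)] infmat_scale_mult[OF S(1) Z] S
    by (simp_all add: infmat_scale_def)
  moreover from this have "infmat_inv (2 *\<^sub>m Z) = C"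
    using infmat_inv_eqI[OF rows_le_scale[OF Z] C] by blast
  ultimately show "rows_le (infmat_inv (2 *\<^sub>m infmat_id - Y)) 1"
    "infmat_inv (2 *\<^sub>m infmat_id - Y) **\<^sub>m (2 *\<^sub>m infmat_id - Y) = infmat_id"
    using C by (simp_all add: eq)
qed

section \<open>Norm of the Toeplitz part\<close>

text \<open>Shifting both indices by \<open>m\<close> leaves Toeplitz entries unchanged but moves to
  a row of \<open>E\<close> whose absolute sum tends to 0. So any finite piece of a Toeplitz row is
  bounded by \<open>K\<close> plus an error that vanishes as \<open>m\<close> grows.\<close>

lemma rows_le_toeplitz:
  assumes B: "rows_le (toeplitz b + E) K" and E: "E \<in> Kd_linf"
  shows "rows_le (toeplitz b) K"
proof -
  let ?T = "toeplitz b"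
  obtain M where M: "rows_le E M"
    using E by (auto simp: Kd_linf_def linf_bounded_iff_rows_le)
  have part: "(\<Sum>j<n. norm (?T i j)) \<le> K" for i n
  proof -
    have "(\<Sum>j<n. norm (?T i j)) \<le> K + (\<Sum>j. norm (E (i + m) j))" for m
    proof -
      have shift: "(\<Sum>j<n. norm (G (i + m) (j + m))) \<le> (\<Sum>j. norm (G (i + m) j))"
        if "rows_le G L" for G :: infmat and L
      proof -
        \<comment> \<open>The shifted columns form a finite part of row \<open>i + m\<close>, hence
          the bound by the full row sum.\<close>
        have "(\<Sum>j<n. norm (G (i + m) (j + m))) = (\<Sum>j\<in>(\<lambda>j. j + m) ` {..<n}. norm (G (i + m) j))"
          by (simp add: sum.reindex)
        also have "\<dots> \<le> (\<Sum>j. norm (G (i + m) j))"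
          by (intro sum_le_suminf rows_leD(1)[OF that]) auto
        finally show ?thesis .
      qed
      have "?T i j = (?T + E) (i + m) (j + m) - E (i + m) (j + m)" for j
        by (simp add: toeplitz_def)
      then have "(\<Sum>j<n. norm (?T i j))
          \<le> (\<Sum>j<n. norm ((?T + E) (i + m) (j + m)) + norm (E (i + m) (j + m)))"
        by (intro sum_mono) (metis norm_triangle_ineq4)
      also have "\<dots> \<le> K + (\<Sum>j. norm (E (i + m) j))"
        using shift[OF B] shift[OF M] rows_leD(2)[OF B, of "i + m"] by (simp add: sum.distrib)
      finally show ?thesis .
    qed
    \<comment> \<open>The partial sum being bounded does not depend on \<open>m\<close>, so it is at
      most the limit of the bounds.\<close>
    moreover have "(\<lambda>m. K + (\<Sum>j. norm (E (i + m) j))) \<longlonglongrightarrow> K + 0"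
      using E LIMSEQ_ignore_initial_segment[of "\<lambda>m. \<Sum>j. norm (E m j)" 0 i]
      by (intro tendsto_add) (auto simp: Kd_linf_def add.commute)
    ultimately show ?thesis
      using LIMSEQ_le_const[of _ "K + 0"] by fastforce
  qed
  have "summable (\<lambda>j. norm (?T i j))" for i
    by (rule summableI_nonneg_bounded[of _ K]) (auto simp: part)
  then show ?thesis
    using part by (intro rows_leI suminf_le_const)
qed

section \<open>The iteration and its geometric convergence\<close>

theorem theorem3p2:
  fixes A A1 B E_B Q :: infmat
    and b :: "complex \<Rightarrow> complex"
    and \<beta> :: real
    and X :: "nat \<Rightarrow> infmat"
  assumes "A \<in> QT_linf"
    and "A = of_real \<beta> *\<^sub>m (infmat_id - A1)" and "\<beta> > 0"
    and "infmat_nonneg A1" and "linf_norm A1 < 1"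
    and "b \<in> wiener" and "E_B \<in> Kd_linf" and "B = toeplitz b + E_B"
    and "infmat_nonneg B" and "linf_norm B < 1"
    and "(infmat_id - B) **\<^sub>m (infmat_id - B) = infmat_id - A1"
    and "Q = A1 + toeplitz b **\<^sub>m toeplitz b - 2 *\<^sub>m toeplitz b"
    and "X 0 = 0"
    and "\<And>k. X (Suc k) =
           infmat_inv (2 *\<^sub>m infmat_id - toeplitz b - X k) **\<^sub>m (Q + X k **\<^sub>m toeplitz b)"
  shows "(\<lambda>k. linf_norm (E_B - X k)) \<longlonglongrightarrow> 0"
proof -
  obtain a where a: "a < 1" "rows_le A1 a"
    using assms(5) by (rule linf_norm_less_oneE)
  obtain q where q: "0 \<le> q" "q < 1" and B: "rows_le B q"
    using assms(10) by (rule linf_norm_less_oneE)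
  define T where "T = toeplitz b"
  define Y where "Y k = T + X k" for k
  define R where "R k = infmat_inv (2 *\<^sub>m infmat_id - Y k)" for k
  have A1: "rows_le A1 1" using a by (auto intro: rows_le_mono)
  have T: "rows_le T q"
    using rows_le_toeplitz[of b E_B q] B assms(7,8) by (simp add: T_def)
  have two_id: "rows_le (2 *\<^sub>m infmat_id) 2"
    using rows_le_scale[OF rows_le_id, of 2] by simp
  have two: "(2 *\<^sub>m infmat_id) **\<^sub>m C = 2 *\<^sub>m C" if "rows_le C K" for C K
    using infmat_scale_mult(1)[OF rows_le_id that] by simp
  \<comment> \<open>Expanding the square equation gives \<open>(2I - B) B = A1\<close>, the
    fixed-point equation of the iteration for \<open>Y\<close>.\<close>
  have BB: "(2 *\<^sub>m infmat_id) **\<^sub>m B - B **\<^sub>m B = A1"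
  proof -
    have I: "rows_le (infmat_id - B) (1 + q)" by (intro rows_le_diff rows_le_id B)
    have "infmat_id - A1 = infmat_id - B - (B - B **\<^sub>m B)"
      using assms(11) infmat_mult_diff_right[OF I rows_le_id B] infmat_mult_diff_left[OF rows_le_id B B]
      by simp
    then show ?thesis
      unfolding two[OF B] by (simp add: fun_eq_iff infmat_scale_def algebra_simps)
  qed
  have step: "rows_le (Y (Suc k)) 1 \<and> B - Y (Suc k) = R k **\<^sub>m ((B - Y k) **\<^sub>m B)"
    if Y: "rows_le (Y k) 1" for k
  proof -
    define W where "W = 2 *\<^sub>m infmat_id - Y k"
    have W: "rows_le W (2 + 1)"
      unfolding W_def by (intro rows_le_diff two_id Y)
    have R: "rows_le (R k) 1" and RW: "R k **\<^sub>m W = infmat_id"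
      using infmat_inv_two_minus[OF Y] by (simp_all add: R_def W_def)
    have cancel: "R k **\<^sub>m (W **\<^sub>m C) = C" if "rows_le C K" for C K
      using infmat_mult_assoc[OF R W that] RW by simp
    have WT: "W **\<^sub>m T = 2 *\<^sub>m T - Y k **\<^sub>m T"
      using infmat_mult_diff_left[OF two_id Y T] two[OF T] by (simp add: W_def)
    have XT: "X k **\<^sub>m T = Y k **\<^sub>m T - T **\<^sub>m T"
      using infmat_mult_diff_left[OF Y T T] by (simp add: Y_def)
    have "X (Suc k) = R k **\<^sub>m (Q + X k **\<^sub>m T)"
      unfolding R_def Y_def T_def using assms(14)[of k] by (simp add: diff_diff_eq)
    \<comment> \<open>With \<open>X k = Y k - T\<close> the squares of \<open>T\<close> cancel,
      leaving \<open>A1 - (2T - Y k T)\<close>. The factor \<open>W\<close> is then removed by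
      \<open>R k\<close>, and the resulting \<open>-T\<close> is absorbed in passing from
      \<open>X\<close> to \<open>Y\<close>.\<close>
    also have "Q + X k **\<^sub>m T = A1 - W **\<^sub>m T"
      unfolding XT WT assms(12)[folded T_def] by (simp add: algebra_simps)
    also have "R k **\<^sub>m (A1 - W **\<^sub>m T) = R k **\<^sub>m A1 - T"
      using infmat_mult_diff_right[OF R A1 rows_le_mult[OF W T]] cancel[OF T] by simp
    finally have Ys: "Y (Suc k) = R k **\<^sub>m A1" by (simp add: Y_def)
    \<comment> \<open>Writing \<open>A1\<close> as \<open>2B - B B\<close> cancels the terms
      \<open>2B\<close>.\<close>
    have WB: "W **\<^sub>m B - A1 = (B - Y k) **\<^sub>m B"
      unfolding W_def infmat_mult_diff_left[OF two_id Y B] infmat_mult_diff_left[OF B Y B]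
        BB[symmetric] by simp
    have "B - Y (Suc k) = R k **\<^sub>m (W **\<^sub>m B) - R k **\<^sub>m A1"
      by (simp add: Ys cancel[OF B])
    also have "\<dots> = R k **\<^sub>m ((B - Y k) **\<^sub>m B)"
      using infmat_mult_diff_right[OF R rows_le_mult[OF W B] A1] WB by simp
    finally show ?thesis
      using rows_le_mult[OF R A1] Ys by simp
  qed
  have Y: "rows_le (Y k) 1" for k
  proof (induction k)
    case 0
    show ?case using rows_le_mono[OF T, of 1] q assms(13) by (simp add: Y_def)
  qed (use step in blast)
  \<comment> \<open>The constant 2 dominates \<open>q + 1\<close>, the sum of the bounds for
    \<open>B\<close> and \<open>Y 0\<close>. Each step gains a factor \<open>q\<close> from the
    multiplication by \<open>B\<close>, while \<open>R k\<close> has bound 1.\<close>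
  have err: "rows_le (B - Y k) (2 * q ^ k)" for k
  proof (induction k)
    case 0
    show ?case
      by (rule rows_le_mono[OF rows_le_diff[OF B Y]]) (use q in simp)
  next
    case (Suc k)
    have "rows_le (R k) 1" using infmat_inv_two_minus(1)[OF Y] by (simp add: R_def)
    from rows_le_mult[OF this rows_le_mult[OF Suc B]]
    have "rows_le (R k **\<^sub>m ((B - Y k) **\<^sub>m B)) (2 * q ^ Suc k)"
      by (simp only: mult_ac power_Suc mult_1_left)
    then show ?case
      by (simp only: step[OF Y])
  qed
  have "E_B - X k = B - Y k" for k
    by (simp add: assms(8) Y_def T_def)
  then have le: "linf_norm (E_B - X k) \<le> ennreal (2 * q ^ k)" for k
    using err q by (simp add: linf_norm_le_iff)
  have "(\<lambda>k. 2 * q ^ k) \<longlonglongrightarrow> 2 * 0"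
    using q by (intro tendsto_mult tendsto_const LIMSEQ_realpow_zero)
  from tendsto_ennrealI[OF this] have lim: "(\<lambda>k. ennreal (2 * q ^ k)) \<longlonglongrightarrow> 0" by simp
  show ?thesis
    by (rule tendsto_sandwich[OF _ _ tendsto_const lim]) (auto simp: le)
qed

end
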